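(* Let $\epsilon>0$, $n\ge1$, $J\ge1$, $M>2$, and let $C_{J,M}=\{f_1,\dots,f_N\}$ be a finite nonempty subset of $V_J\cap\mathcal X(2M)$ (not depending on the data). Let $L_1,\dots,L_N$ be i.i.d. standard Laplace random variables (density $t\mapsto\frac12e^{-|t|}$), independent of all other sources of randomness. For a dataset $D=(X_{1:n},Y_{1:n})$ let $$\hat i_{\mathrm{priv}}(D)\in\operatorname*{argmin}_{i\in\{1,\dots,N\}}\left\{\hat S(f_i|D)+\frac{\max(32M^2,36d)}{n\epsilon}L_i\right\}$$ (a random index in the argmin if it is not unique). Then the mechanism that returns the pair $(\hat f_{\mathrm{priv}},\hat T_{\mathrm{priv}})=(f_{\hat i_{\mathrm{priv}}},\nabla f_{\hat i_{\mathrm{priv}}})$ is $\epsilon$-differentially private.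
   Context: Let $\Omega=[0,1]^d$ and $\tilde\Omega=[-1,2]^d$. Datasets are $D=(X_{1:n},Y_{1:n})\in\Omega^n\times\Omega^n$. Two datasets are neighboring if their Hamming distance is at most $1$, i.e. they differ in at most one of the $2n$ entries. A randomized mechanism $\mathsf A$ is $\epsilon$-differentially private if for all neighboring $D,D'$ and all measurable sets $S$ of outputs, $\mathbb P(\mathsf A(D)\in S)\le e^\epsilon\,\mathbb P(\mathsf A(D')\in S)$. Empirical semi-dual: $\hat S(f|X_{1:n},Y_{1:n})=\frac1n\sum_{i=1}^nf(X_i)+\frac1n\sum_{i=1}^nf^*(Y_i)$, with $f^*(y)=\sup_{x\in\tilde\Omega}\langle x,y\rangle-f(x)$. $\mathcal X(2M)$ is the set of twice continuously differentiable $f:\tilde\Omega\to\mathbb R$ with $|f(x)|\le 8M^2$, $\|\nabla f(x)\|\le 2M$ and $\frac1{2M}I_d\preceq\nabla^2f(x)\preceq 2M I_d$ for all $x\in\tilde\Omega$. Wavelet spaces: fix compactly supported, smooth enough father and mother wavelets $\psi_F,\psi_M$ on $\mathbb R$ generating an orthonormal wavelet basis. Let $G^0=\{F,M\}^d$, $G^j=\{F,M\}^d\setminus\{(F,\dots,F)\}$ for $j\ge1$, and $\Psi^{j,g}_k(x)=2^{jd/2}\prod_{i=1}^d\psi_{g_i}(2^jx_i-k_i)$ for $j\in\mathbb N$, $g\in G^j$, $k\in\mathbb Z^d$; this is an orthonormal basis of $L^2(\mathbb R^d)$. Let $K_j\subset\mathbb Z^d$ be the finite set of $k$ such that some $\Psi^{j,g}_k$,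 $g\in G^j$, does not vanish identically on $\tilde\Omega$. Put $V_J=\mathrm{Span}\{\Psi^{j,g}_k: j\le J,\ k\in K_j,\ g\in G^j\}$. $V_J\cap\mathcal X(2M)$ is the set of elements of $V_J$ whose restriction to $\tilde\Omega$ lies in $\mathcal X(2M)$. *)

theory Defs
  imports "HOL-Probability.Probability"
begin

definition Omega :: "(real ^ 'd) set" where
  "Omega = {x. \<forall>i. 0 \<le> x $ i \<and> x $ i \<le> 1}"

definition Omega_tilde :: "(real ^ 'd) set" where
  "Omega_tilde = {x. \<forall>i. - 1 \<le> x $ i \<and> x $ i \<le> 2}"

type_synonym 'd dataset = "(nat \<Rightarrow> real ^ 'd) \<times> (nat \<Rightarrow> real ^ 'd)"

definition datasets :: "nat \<Rightarrow> ('d::finite) dataset set" where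
  "datasets n = ({1..n} \<rightarrow>\<^sub>E Omega) \<times> ({1..n} \<rightarrow>\<^sub>E Omega)"

definition hamming :: "nat \<Rightarrow> ('d::finite) dataset \<Rightarrow> 'd dataset \<Rightarrow> nat" where
  "hamming n D D' = card {i \<in> {1..n}. fst D i \<noteq> fst D' i} + card {i \<in> {1..n}. snd D i \<noteq> snd D' i}"

definition neighboring :: "nat \<Rightarrow> ('d::finite) dataset \<Rightarrow> 'd dataset \<Rightarrow> bool" where
  "neighboring n D D' \<longleftrightarrow> hamming n D D' \<le> 1"

text \<open>A randomized mechanism sends each input to a probability law on the output space \<open>Out\<close>.\<close>

definition differentially_private ::
  "real \<Rightarrow> 'a set \<Rightarrow> ('a \<Rightarrow> 'a \<Rightarrow> bool) \<Rightarrow> 'b measure \<Rightarrow> ('a \<Rightarrow> 'b measure) \<Rightarrow> bool" where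
  "differentially_private \<epsilon> Inp nb Out A \<longleftrightarrow>
     (\<forall>D\<in>Inp. A D \<in> space (prob_algebra Out)) \<and>
     (\<forall>D\<in>Inp. \<forall>D'\<in>Inp. nb D D' \<longrightarrow>
        (\<forall>S\<in>sets Out. measure (A D) S \<le> exp \<epsilon> * measure (A D') S))"

definition conj_tilde :: "(real ^ 'd \<Rightarrow> real) \<Rightarrow> real ^ 'd \<Rightarrow> real" where
  "conj_tilde f y = (SUP x\<in>Omega_tilde. x \<bullet> y - f x)"

definition S_hat :: "nat \<Rightarrow> (real ^ 'd \<Rightarrow> real) \<Rightarrow> 'd dataset \<Rightarrow> real" where
  "S_hat n f D = (1 / real n) * (\<Sum>i=1..n. f (fst D i)) + (1 / real n) * (\<Sum>i=1..n. conj_tilde f (snd D i))"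

text \<open>Derivatives on the closed cube are taken within the cube; since it is convex with nonempty
  interior they are unique, and being twice continuously differentiable in this sense is the same
  as being so in the interior with all derivatives extending continuously to the boundary.\<close>

definition grad_on :: "(real ^ 'd) set \<Rightarrow> (real ^ 'd \<Rightarrow> real) \<Rightarrow> real ^ 'd \<Rightarrow> real ^ 'd" where
  "grad_on S f x = (\<chi> i. frechet_derivative f (at x within S) (axis i 1))"

definition hess_on :: "(real ^ 'd) set \<Rightarrow> (real ^ 'd \<Rightarrow> real) \<Rightarrow> real ^ 'd \<Rightarrow> real ^ 'd ^ 'd" where
  "hess_on S f x = matrix (frechet_derivative (grad_on S f) (at x within S))"

definition C2_on :: "(real ^ 'd) set \<Rightarrow> (real ^ 'd \<Rightarrow> real) \<Rightarrow> bool" where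
  "C2_on S f \<longleftrightarrow> f differentiable_on S \<and> grad_on S f differentiable_on S \<and> continuous_on S (hess_on S f)"

text \<open>Only used between symmetric matrices (Hessians and multiples of the identity).\<close>

definition loewner_le :: "real ^ 'd ^ 'd \<Rightarrow> real ^ 'd ^ 'd \<Rightarrow> bool" where
  "loewner_le A B \<longleftrightarrow> (\<forall>v. 0 \<le> v \<bullet> ((B - A) *v v))"

text \<open>The class \<open>\<X>(2M)\<close>, as the set of functions on the whole space whose restriction to the
  enlarged cube belongs to it; values outside the cube play no role.\<close>

definition calX_2 :: "real \<Rightarrow> (real ^ 'd \<Rightarrow> real) set" where
  "calX_2 M = {f. C2_on Omega_tilde f \<and>
     (\<forall>x\<in>Omega_tilde. \<bar>f x\<bar> \<le> 8 * M\<^sup>2 \<and> norm (grad_on Omega_tilde f x) \<le> 2 * M \<and>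
        loewner_le ((1 / (2 * M)) *\<^sub>R mat 1) (hess_on Omega_tilde f x) \<and>
        loewner_le (hess_on Omega_tilde f x) ((2 * M) *\<^sub>R mat 1))}"

datatype wavelet_kind = Father | Mother

text \<open>An orthonormal family in the real \<open>L\<^sup>2(\<mu>)\<close> whose finite linear combinations are dense.\<close>

definition orthonormal_basis_L2 :: "'x measure \<Rightarrow> 'i set \<Rightarrow> ('i \<Rightarrow> 'x \<Rightarrow> real) \<Rightarrow> bool" where
  "orthonormal_basis_L2 \<mu> I b \<longleftrightarrow>
     (\<forall>a\<in>I. b a \<in> borel_measurable \<mu> \<and> integrable \<mu> (\<lambda>x. (b a x)\<^sup>2)) \<and>
     (\<forall>a\<in>I. \<forall>a'\<in>I. (LINT x|\<mu>. b a x * b a' x) = (if a = a' then 1 else 0)) \<and>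
     (\<forall>h \<in> borel_measurable \<mu>. integrable \<mu> (\<lambda>x. (h x)\<^sup>2) \<longrightarrow>
        (\<forall>e>0. \<exists>A c. finite A \<and> A \<subseteq> I \<and> (LINT x|\<mu>. (h x - (\<Sum>a\<in>A. c a * b a x))\<^sup>2) < e))"

definition wavelet_1d :: "(wavelet_kind \<Rightarrow> real \<Rightarrow> real) \<Rightarrow> wavelet_kind \<times> nat \<times> int \<Rightarrow> real \<Rightarrow> real" where
  "wavelet_1d \<psi> = (\<lambda>(t, j, k) x. 2 powr (real j / 2) * \<psi> t (2 ^ j * x - of_int k))"

text \<open>``Smooth enough'' is read as twice continuously differentiable: this is the least regularity
  making the functions in the wavelet spaces \<open>C\<^sup>2\<close>, and any smoother choice is a special case.
  Generating an orthonormal wavelet basis means that the translates \<open>\<psi>\<^sub>F(x - k)\<close> together with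
  \<open>2\<^bsup>j/2\<^esup> \<psi>\<^sub>M(2\<^sup>j x - k)\<close>, \<open>j \<ge> 0\<close>, form an orthonormal basis of \<open>L\<^sup>2\<close> of the line. The dilates of this
  basis are again orthonormal bases, so this contains the multiresolution structure
  behind the tensor-product basis in dimension \<open>d\<close>.\<close>

definition wavelet_system :: "(wavelet_kind \<Rightarrow> real \<Rightarrow> real) \<Rightarrow> bool" where
  "wavelet_system \<psi> \<longleftrightarrow>
     (\<forall>t. compact (closure {x. \<psi> t x \<noteq> 0}) \<and>
        (\<forall>x. \<psi> t field_differentiable at x) \<and> (\<forall>x. deriv (\<psi> t) field_differentiable at x) \<and>
        continuous_on UNIV (deriv (deriv (\<psi> t)))) \<and>
     orthonormal_basis_L2 lborel ({Father} \<times> {0} \<times> UNIV \<union> {Mother} \<times> UNIV \<times> UNIV) (wavelet_1d \<psi>)"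

definition Gset :: "nat \<Rightarrow> ('d \<Rightarrow> wavelet_kind) set" where
  "Gset j = (if j = 0 then UNIV else UNIV - {\<lambda>_. Father})"

definition Psi :: "(wavelet_kind \<Rightarrow> real \<Rightarrow> real) \<Rightarrow> nat \<Rightarrow> ('d \<Rightarrow> wavelet_kind) \<Rightarrow> int ^ 'd \<Rightarrow> real ^ 'd \<Rightarrow> real" where
  "Psi \<psi> j g k x = 2 powr (real j * real CARD('d) / 2) * (\<Prod>i\<in>UNIV. \<psi> (g i) (2 ^ j * x $ i - of_int (k $ i)))"

definition Kset :: "(wavelet_kind \<Rightarrow> real \<Rightarrow> real) \<Rightarrow> nat \<Rightarrow> (int ^ 'd) set" where
  "Kset \<psi> j = {k. \<exists>g\<in>Gset j. \<exists>x\<in>Omega_tilde. Psi \<psi> j g k x \<noteq> 0}"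

definition Vidx :: "(wavelet_kind \<Rightarrow> real \<Rightarrow> real) \<Rightarrow> nat \<Rightarrow> (nat \<times> ('d \<Rightarrow> wavelet_kind) \<times> (int ^ 'd)) set" where
  "Vidx \<psi> J = {(j, g, k). j \<le> J \<and> k \<in> Kset \<psi> j \<and> g \<in> Gset j}"

definition Vspace :: "(wavelet_kind \<Rightarrow> real \<Rightarrow> real) \<Rightarrow> nat \<Rightarrow> (real ^ 'd \<Rightarrow> real) set" where
  "Vspace \<psi> J = {f. \<exists>A c. finite A \<and> A \<subseteq> Vidx \<psi> J \<and>
     f = (\<lambda>x. \<Sum>(j, g, k)\<in>A. c (j, g, k) * Psi \<psi> j g k x)}"

definition laplace_density :: "real \<Rightarrow> real" where
  "laplace_density t = 1 / 2 * exp (- \<bar>t\<bar>)"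

text \<open>The library's \<open>indep_var\<close>, unfolded by \<open>indep_var_eq\<close>, for values in two different types.\<close>

definition indep_rv :: "'w measure \<Rightarrow> 'a measure \<Rightarrow> ('w \<Rightarrow> 'a) \<Rightarrow> 'b measure \<Rightarrow> ('w \<Rightarrow> 'b) \<Rightarrow> bool" where
  "indep_rv P S X T Y \<longleftrightarrow> X \<in> measurable P S \<and> Y \<in> measurable P T \<and>
     prob_space.indep_set P
       (sigma_sets (space P) {X -` A \<inter> space P | A. A \<in> sets S})
       (sigma_sets (space P) {Y -` A \<inter> space P | A. A \<in> sets T})"

end

(* Replacing one X-entry moves the score S_hat by at most 16 M^2 / n, since |f| <= 8 M^2; replacing one
   Y-entry moves it by at most 2 d / n, since the conjugate is a supremum of the affine functions
   y |-> <x, y> - f(x) with |x_i| <= 2.  So all scores move by at most some Delta, and 2 Delta is at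
   most epsilon times the noise scale.  Index i is selected when L i lies below a threshold determined
   by the other noise variables, and passing to a neighbouring dataset moves this threshold by at
   most 2 Delta in units of the noise scale.  The Laplace density changes by a factor at most exp c
   under a translation by c.  Taking c > epsilon makes the inequalities between the noisy scores
   strict, so ties need no separate treatment; then c is sent to epsilon. *)
theory Submission
  imports Defs
begin

section \<open>Translating the Laplace law, in one variable and in one coordinate of a
  product\<close>

lemma laplace_density_measurable [measurable]: "laplace_density \<in> borel_measurable borel"
  unfolding laplace_density_def by measurable

text \<open>The triangle inequality \<open>\<bar>t - c\<bar> \<le> \<bar>t\<bar> + c\<close>,
  exponentiated.\<close>

lemma laplace_density_shift:
  assumes "c \<ge> 0"
  shows "laplace_density t \<le> exp c * laplace_density (t - c)"
proof -
  have "exp (- \<bar>t\<bar>) \<le> exp (c + - \<bar>t - c\<bar>)"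
    using assms by (subst exp_le_cancel_iff) linarith
  then show ?thesis
    by (simp add: laplace_density_def exp_add[symmetric])
qed

text \<open>The pointwise density bound is integrated against \<open>g\<close>, and translation
  invariance of Lebesgue measure then moves the shift from the density to the argument of
  \<open>g\<close>.\<close>

lemma nn_integral_laplace_shift:
  fixes c :: real
  assumes [measurable]: "g \<in> borel_measurable borel" and "c \<ge> 0"
  shows "(\<integral>\<^sup>+t. g t \<partial>density lborel (\<lambda>t. ennreal (laplace_density t)))
    \<le> ennreal (exp c) * (\<integral>\<^sup>+t. g (t + c) \<partial>density lborel (\<lambda>t. ennreal (laplace_density t)))"
proof -
  have "(\<integral>\<^sup>+t. ennreal (laplace_density t) * g t \<partial>lborel)
      \<le> (\<integral>\<^sup>+t. ennreal (exp c) * (ennreal (laplace_density (t - c)) * g t) \<partial>lborel)"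
  proof (intro nn_integral_mono)
    fix t
    have "ennreal (laplace_density t) \<le> ennreal (exp c) * ennreal (laplace_density (t - c))"
      using laplace_density_shift[OF assms(2), of t]
      by (simp add: ennreal_mult'[symmetric] ennreal_leI)
    then show "ennreal (laplace_density t) * g t
        \<le> ennreal (exp c) * (ennreal (laplace_density (t - c)) * g t)"
      by (metis mult.assoc mult_right_mono zero_le)
  qed
  also have "\<dots> = ennreal (exp c) * (\<integral>\<^sup>+t. ennreal (laplace_density (t - c)) * g t \<partial>lborel)"
    by (rule nn_integral_cmult) measurable
  also have "(\<integral>\<^sup>+t. ennreal (laplace_density (t - c)) * g t \<partial>lborel)
      = (\<integral>\<^sup>+t. ennreal (laplace_density t) * g (t + c) \<partial>lborel)"
    by (subst nn_integral_real_affine[where c = 1 and t = c]) (auto simp: add.commute)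
  finally show ?thesis
    by (simp add: nn_integral_density)
qed

text \<open>Spares integrating the Laplace density: its total mass is 1 because some random variable
  on a probability space has it as its law.\<close>

lemma prob_space_distributed_density:
  assumes "prob_space P" and "distributed P lborel X p"
  shows "prob_space (density lborel p)"
  using prob_space.prob_space_distr[OF assms(1), of X lborel] assms(2)
  by (simp add: distributed_def)

text \<open>By Fubini, coordinate \<open>i\<close> is integrated first with the others frozen. The
  one-dimensional shift applies to the section of \<open>A\<close>, and \<open>AB\<close> says that
  the section of \<open>A\<close>, translated down by \<open>c\<close>, lies in the section of
  \<open>B\<close>.\<close>

lemma emeasure_PiM_laplace_shift:
  fixes A B :: "('i \<Rightarrow> real) set"
  defines "Q \<equiv> density lborel (\<lambda>t. ennreal (laplace_density t))"
  assumes "prob_space Q" and "finite I" and "i \<in> I" and "c \<ge> 0"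
    and A: "A \<in> sets (Pi\<^sub>M I (\<lambda>_. Q))" and B: "B \<in> sets (Pi\<^sub>M I (\<lambda>_. Q))"
    and AB: "\<And>l. l \<in> space (Pi\<^sub>M I (\<lambda>_. Q)) \<Longrightarrow> l(i := l i + c) \<in> A \<Longrightarrow> l \<in> B"
  shows "emeasure (Pi\<^sub>M I (\<lambda>_. Q)) A \<le> ennreal (exp c) * emeasure (Pi\<^sub>M I (\<lambda>_. Q)) B"
proof -
  interpret Q: prob_space Q by fact
  interpret product_sigma_finite "\<lambda>_. Q"
    by unfold_locales
  define K where "K = I - {i}"
  have K: "finite K" "i \<notin> K" and I: "I = insert i K"
    using assms(3,4) by (auto simp: K_def)
  have sQ: "sets Q = sets borel" "space Q = UNIV"
    by (auto simp: Q_def)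
  have upd: "(\<lambda>y. l(i := y)) \<in> borel \<rightarrow>\<^sub>M Pi\<^sub>M I (\<lambda>_. Q)" if "l \<in> space (Pi\<^sub>M K (\<lambda>_. Q))" for l
  proof -
    have "(\<lambda>y. l(i := y)) \<in> Q \<rightarrow>\<^sub>M Pi\<^sub>M (insert i K) (\<lambda>_. Q)"
      using that by (intro measurable_fun_upd[where J = K]) auto
    then show ?thesis
      by (simp add: I measurable_cong_sets[OF sQ(1) refl])
  qed
  have split: "emeasure (Pi\<^sub>M I (\<lambda>_. Q)) E
      = (\<integral>\<^sup>+l. (\<integral>\<^sup>+y. indicator E (l(i := y)) \<partial>Q) \<partial>Pi\<^sub>M K (\<lambda>_. Q))"
    if "E \<in> sets (Pi\<^sub>M I (\<lambda>_. Q))" for E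
  proof -
    have "emeasure (Pi\<^sub>M I (\<lambda>_. Q)) E = (\<integral>\<^sup>+l. indicator E l \<partial>Pi\<^sub>M I (\<lambda>_. Q))"
      using that by simp
    also have "\<dots> = (\<integral>\<^sup>+l. (\<integral>\<^sup>+y. indicator E (l(i := y)) \<partial>Q) \<partial>Pi\<^sub>M K (\<lambda>_. Q))"
      unfolding I using K that by (intro product_nn_integral_insert) (auto simp: I)
    finally show ?thesis .
  qed
  \<comment> \<open>Required for pulling \<open>exp c\<close> out of the outer integral at the
    end.\<close>
  have inner_measurable: "(\<lambda>l. \<integral>\<^sup>+y. indicator B (l(i := y)) \<partial>Q) \<in> borel_measurable (Pi\<^sub>M K (\<lambda>_. Q))"
  proof -
    have "(\<lambda>(l, y). l(i := y)) \<in> Pi\<^sub>M K (\<lambda>_. Q) \<Otimes>\<^sub>M Q \<rightarrow>\<^sub>M Pi\<^sub>M I (\<lambda>_. Q)"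
      unfolding I by (rule measurable_add_dim)
    then have "(\<lambda>z. indicator B ((\<lambda>(l, y). l(i := y)) z) :: ennreal)
        \<in> borel_measurable (Pi\<^sub>M K (\<lambda>_. Q) \<Otimes>\<^sub>M Q)"
      by (rule measurable_compose[OF _ borel_measurable_indicator[OF B]])
    then show ?thesis
      by (intro Q.borel_measurable_nn_integral) (simp add: case_prod_unfold)
  qed
  have "emeasure (Pi\<^sub>M I (\<lambda>_. Q)) A
      \<le> (\<integral>\<^sup>+l. ennreal (exp c) * (\<integral>\<^sup>+y. indicator B (l(i := y)) \<partial>Q) \<partial>Pi\<^sub>M K (\<lambda>_. Q))"
    unfolding split[OF A]
  proof (intro nn_integral_mono)
    fix l assume l: "l \<in> space (Pi\<^sub>M K (\<lambda>_. Q))"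
    have "(\<integral>\<^sup>+y. indicator A (l(i := y)) \<partial>Q)
        \<le> ennreal (exp c) * (\<integral>\<^sup>+y. indicator A (l(i := y + c)) \<partial>Q)"
      unfolding Q_def
      using measurable_compose[OF upd[OF l] borel_measurable_indicator[OF A]] \<open>c \<ge> 0\<close>
      by (intro nn_integral_laplace_shift) auto
    also have "\<dots> \<le> ennreal (exp c) * (\<integral>\<^sup>+y. indicator B (l(i := y)) \<partial>Q)"
    proof (intro mult_left_mono nn_integral_mono)
      fix y
      have "l(i := y) \<in> space (Pi\<^sub>M I (\<lambda>_. Q))"
        using measurable_space[OF upd[OF l], of y] by simp
      from AB[OF this] show "(indicator A (l(i := y + c)) :: ennreal) \<le> indicator B (l(i := y))"
        by (auto simp: indicator_def)
    qed simp
    finally show "(\<integral>\<^sup>+y. indicator A (l(i := y)) \<partial>Q)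
        \<le> ennreal (exp c) * (\<integral>\<^sup>+y. indicator B (l(i := y)) \<partial>Q)" .
  qed
  also have "\<dots> = ennreal (exp c) * emeasure (Pi\<^sub>M I (\<lambda>_. Q)) B"
    unfolding split[OF B] by (rule nn_integral_cmult[OF inner_measurable])
  finally show ?thesis .
qed

section \<open>Private selection of the minimiser of noisy scores\<close>

text \<open>\<open>X\<close> and \<open>X'\<close> enter through two inclusions only:
  \<open>X = i\<close> forces \<open>i\<close> to be a minimiser for \<open>s\<close>, and
  \<open>i\<close> being the unique minimiser for \<open>s'\<close> forces \<open>X' = i\<close>.
  Both bounding events depend on the noise alone, so every measurable rule for breaking ties is
  covered.\<close>

lemma report_noisy_min:
  fixes L :: "'i \<Rightarrow> 'w \<Rightarrow> real" and s s' :: "'i \<Rightarrow> real"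
  assumes "prob_space P" and "finite I"
    and L: "\<And>i. i \<in> I \<Longrightarrow> distributed P lborel (L i) (\<lambda>t. ennreal (laplace_density t))"
    and indep: "prob_space.indep_vars P (\<lambda>_. borel) L I"
    and "lam > 0" and "2 * \<Delta> \<le> lam * \<epsilon>" and "\<epsilon> \<ge> 0"
    and sens: "\<And>i. i \<in> I \<Longrightarrow> \<bar>s i - s' i\<bar> \<le> \<Delta>"
    and X [measurable]: "X \<in> P \<rightarrow>\<^sub>M count_space UNIV"
    and X' [measurable]: "X' \<in> P \<rightarrow>\<^sub>M count_space UNIV"
    and amin: "\<And>\<omega>. \<omega> \<in> space P \<Longrightarrow> is_arg_min (\<lambda>i. s i + lam * L i \<omega>) (\<lambda>i. i \<in> I) (X \<omega>)"
    and amin': "\<And>\<omega>. \<omega> \<in> space P \<Longrightarrow> is_arg_min (\<lambda>i. s' i + lam * L i \<omega>) (\<lambda>i. i \<in> I) (X' \<omega>)"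
  shows "measure P (X -` V \<inter> space P) \<le> exp \<epsilon> * measure P (X' -` V \<inter> space P)"
proof -
  interpret P: prob_space P by fact
  define Q where "Q = density lborel (\<lambda>t. ennreal (laplace_density t))"
  have sQ: "sets Q = sets borel"
    by (auto simp: Q_def)
  have sets_PiM_Q: "sets (Pi\<^sub>M I (\<lambda>_. Q)) = sets (Pi\<^sub>M I (\<lambda>_. borel))"
    by (intro sets_PiM_cong) (auto simp: sQ)
  have L_meas [measurable]: "L i \<in> borel_measurable P" if "i \<in> I" for i
    using L[OF that] by (simp add: distributed_def)
  have L_distr: "distr P borel (L i) = Q" if "i \<in> I" for i
    using L[OF that] by (simp add: distributed_def Q_def cong: distr_cong)
  define Z where "Z = (\<lambda>\<omega>. \<lambda>i\<in>I. L i \<omega>)"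
  have Z [measurable]: "Z \<in> P \<rightarrow>\<^sub>M Pi\<^sub>M I (\<lambda>_. borel)"
    unfolding Z_def by measurable
  have single: "measure P (X -` {i} \<inter> space P) \<le> exp \<epsilon> * measure P (X' -` {i} \<inter> space P)"
    if i: "i \<in> I" for i
  proof -
    \<comment> \<open>Proved under \<open>i \<in> I\<close>, since it takes an actual noise variable
      to see that \<open>Q\<close> has mass 1.\<close>
    have pQ: "prob_space Q"
      unfolding Q_def using prob_space_distributed_density[OF assms(1) L[OF i]] .
    \<comment> \<open>Independence enters here: the joint law of the noise is the product law to
      which the coordinate shift applies.\<close>
    have Z_distr: "distr P (Pi\<^sub>M I (\<lambda>_. borel)) Z = Pi\<^sub>M I (\<lambda>_. Q)"
    proof -
      have "distr P (Pi\<^sub>M I (\<lambda>_. borel)) Z = Pi\<^sub>M I (\<lambda>i. distr P borel (L i))"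
        using indep i L_meas unfolding Z_def
        by (subst (asm) P.indep_vars_iff_distr_eq_PiM') auto
      also have "\<dots> = Pi\<^sub>M I (\<lambda>_. Q)"
        by (intro PiM_cong) (auto simp: L_distr)
      finally show ?thesis .
    qed
    \<comment> \<open>\<open>A\<close> has weak inequalities, so that it contains the event
      \<open>X = i\<close>. \<open>B\<close> has strict ones, so that it is contained in
      \<open>X' = i\<close>; there \<open>j = i\<close> has to be excluded.\<close>
    define A where "A = {l \<in> space (Pi\<^sub>M I (\<lambda>_. borel)). \<forall>j\<in>I. s i + lam * l i \<le> s j + lam * l j}"
    define B where
      "B = {l \<in> space (Pi\<^sub>M I (\<lambda>_. borel)). \<forall>j\<in>I - {i}. s' i + lam * l i < s' j + lam * l j}"
    have comp [measurable]: "(\<lambda>l. l j) \<in> borel_measurable (Pi\<^sub>M I (\<lambda>_. borel))" if "j \<in> I" for j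
      using that by (rule measurable_component_singleton)
    have A_sets [measurable]: "A \<in> sets (Pi\<^sub>M I (\<lambda>_. borel))"
      unfolding A_def
    proof (rule sets.sets_Collect_finite_All[OF _ \<open>finite I\<close>])
      fix j assume [simp]: "j \<in> I"
      show "{l \<in> space (Pi\<^sub>M I (\<lambda>_. borel)). s i + lam * l i \<le> s j + lam * l j} \<in> sets (Pi\<^sub>M I (\<lambda>_. borel))"
        using i by measurable
    qed
    have B_sets [measurable]: "B \<in> sets (Pi\<^sub>M I (\<lambda>_. borel))"
      unfolding B_def
    proof (rule sets.sets_Collect_finite_All)
      fix j assume "j \<in> I - {i}"
      then have [simp]: "j \<in> I"
        by simp
      show "{l \<in> space (Pi\<^sub>M I (\<lambda>_. borel)). s' i + lam * l i < s' j + lam * l j} \<in> sets (Pi\<^sub>M I (\<lambda>_. borel))"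
        using i by measurable
    qed (use \<open>finite I\<close> in simp)
    have shift: "measure P (X -` {i} \<inter> space P) \<le> exp c * measure P (X' -` {i} \<inter> space P)"
      if c: "c > \<epsilon>" for c
    proof -
      have AB: "l \<in> B" if l: "l \<in> space (Pi\<^sub>M I (\<lambda>_. Q))" "l(i := l i + c) \<in> A" for l
      proof -
        \<comment> \<open>Replacing \<open>s\<close> by \<open>s'\<close> changes the difference of
          the scores of \<open>i\<close> and \<open>j\<close> by at most
          \<open>2 * \<Delta> \<le> lam * \<epsilon>\<close>, strictly less than the gain
          \<open>lam * c\<close> from lowering coordinate \<open>i\<close> by
          \<open>c\<close>.\<close>
        have "s' i + lam * l i < s' j + lam * l j" if j: "j \<in> I" "j \<noteq> i" for j
        proof -
          have "s i + lam * (l i + c) \<le> s j + lam * l j"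
            using l(2) j by (auto simp: A_def)
          moreover have "lam * \<epsilon> < lam * c"
            using c \<open>lam > 0\<close> by simp
          ultimately show ?thesis
            using sens[OF i] sens[OF j(1)] \<open>2 * \<Delta> \<le> lam * \<epsilon>\<close>
            by (simp add: distrib_left abs_le_iff)
        qed
        then show ?thesis
          using l(1) by (auto simp: B_def sets_eq_imp_space_eq[OF sets_PiM_Q])
      qed
      have "emeasure (Pi\<^sub>M I (\<lambda>_. Q)) A \<le> ennreal (exp c) * emeasure (Pi\<^sub>M I (\<lambda>_. Q)) B"
        unfolding Q_def
        by (rule emeasure_PiM_laplace_shift[OF _ \<open>finite I\<close> i])
          (use pQ A_sets B_sets AB c \<open>\<epsilon> \<ge> 0\<close> in \<open>auto simp: Q_def[symmetric] sets_PiM_Q\<close>)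
      then have "emeasure P (Z -` A \<inter> space P) \<le> ennreal (exp c) * emeasure P (Z -` B \<inter> space P)"
        unfolding Z_distr[symmetric] by (simp add: emeasure_distr)
      then have ZAB: "measure P (Z -` A \<inter> space P) \<le> exp c * measure P (Z -` B \<inter> space P)"
        by (simp add: P.emeasure_eq_measure ennreal_mult'[symmetric])
      have "X -` {i} \<inter> space P \<subseteq> Z -` A \<inter> space P"
      proof
        fix \<omega> assume "\<omega> \<in> X -` {i} \<inter> space P"
        then have \<omega>: "\<omega> \<in> space P" "i = X \<omega>"
          by auto
        then show "\<omega> \<in> Z -` A \<inter> space P"
          using amin[OF \<omega>(1)] measurable_space[OF Z \<omega>(1)] \<omega>(2) i
          by (auto simp: A_def Z_def is_arg_min_linorder)
      qed
      then have "measure P (X -` {i} \<inter> space P) \<le> measure P (Z -` A \<inter> space P)"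
        by (intro P.finite_measure_mono measurable_sets[OF Z A_sets])
      moreover have "Z -` B \<inter> space P \<subseteq> X' -` {i} \<inter> space P"
      proof
        fix \<omega> assume "\<omega> \<in> Z -` B \<inter> space P"
        then have \<omega>: "\<omega> \<in> space P" "Z \<omega> \<in> B"
          by auto
        have "X' \<omega> \<in> I" and "s' (X' \<omega>) + lam * L (X' \<omega>) \<omega> \<le> s' i + lam * L i \<omega>"
          using amin'[OF \<omega>(1)] i by (auto simp: is_arg_min_linorder)
        moreover have "s' i + lam * L i \<omega> < s' j + lam * L j \<omega>" if "j \<in> I" "j \<noteq> i" for j
          using \<omega>(2) i that by (simp add: B_def Z_def)
        ultimately have "X' \<omega> = i"
          by (meson not_less)
        with \<omega>(1) show "\<omega> \<in> X' -` {i} \<inter> space P"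
          by simp
      qed
      then have "measure P (Z -` B \<inter> space P) \<le> measure P (X' -` {i} \<inter> space P)"
        by (intro P.finite_measure_mono) auto
      then have "exp c * measure P (Z -` B \<inter> space P) \<le> exp c * measure P (X' -` {i} \<inter> space P)"
        by simp
      ultimately show ?thesis
        using ZAB by linarith
    qed
    show ?thesis
    \<comment> \<open>The left side does not depend on \<open>c\<close>, so the bound survives the
      limit from the right.\<close>
    proof (rule tendsto_lowerbound)
      show "((\<lambda>c. exp c * measure P (X' -` {i} \<inter> space P))
          \<longlongrightarrow> exp \<epsilon> * measure P (X' -` {i} \<inter> space P)) (at_right \<epsilon>)"
        by (intro tendsto_intros)
      show "\<forall>\<^sub>F c in at_right \<epsilon>.
          measure P (X -` {i} \<inter> space P) \<le> exp c * measure P (X' -` {i} \<inter> space P)"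
        using shift by (auto simp: eventually_at_filter)
    qed simp
  qed
  \<comment> \<open>The selected index lies in the finite set \<open>I\<close>, so an arbitrary
    \<open>V\<close> reduces to singletons, and the bounds add up with the same factor.\<close>
  have decompose: "measure P (R -` V \<inter> space P) = (\<Sum>i\<in>I \<inter> V. measure P (R -` {i} \<inter> space P))"
    if R: "R \<in> P \<rightarrow>\<^sub>M count_space UNIV" and RI: "\<And>\<omega>. \<omega> \<in> space P \<Longrightarrow> R \<omega> \<in> I" for R
  proof -
    have "R -` V \<inter> space P = (\<Union>i\<in>I \<inter> V. R -` {i} \<inter> space P)"
      using RI by auto
    also have "measure P \<dots> = (\<Sum>i\<in>I \<inter> V. measure P (R -` {i} \<inter> space P))"
      using \<open>finite I\<close> R
      by (intro P.finite_measure_finite_Union) (auto simp: disjoint_family_on_def)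
    finally show ?thesis .
  qed
  have "X \<omega> \<in> I" "X' \<omega> \<in> I" if "\<omega> \<in> space P" for \<omega>
    using amin[OF that] amin'[OF that] by (auto simp: is_arg_min_def)
  then show ?thesis
    by (auto simp: decompose[OF X] decompose[OF X'] sum_distrib_left intro!: sum_mono single)
qed

section \<open>Sensitivity of the empirical semi-dual to one data entry\<close>

lemma Omega_subset_Omega_tilde: "Omega \<subseteq> Omega_tilde"
proof
  fix x :: "real ^ 'd" assume "x \<in> Omega"
  then have "0 \<le> x $ i \<and> x $ i \<le> 1" for i
    by (simp add: Omega_def)
  then have "- 1 \<le> x $ i \<and> x $ i \<le> 2" for i
    by (meson le_minus_one_simps(1) one_le_numeral order_trans)
  then show "x \<in> Omega_tilde"
    by (simp add: Omega_tilde_def)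
qed

text \<open>Each coordinate contributes at most 2 times 1: \<open>\<bar>x $ i\<bar> \<le> 2\<close>
  on the enlarged cube, while \<open>y\<close> and \<open>z\<close> differ by at most 1 in each
  coordinate.\<close>

lemma inner_Omega_tilde_diff_le:
  fixes x y z :: "real ^ 'd"
  assumes "x \<in> Omega_tilde" and "y \<in> Omega" and "z \<in> Omega"
  shows "x \<bullet> y - x \<bullet> z \<le> 2 * real CARD('d)"
proof -
  have "x \<bullet> y - x \<bullet> z = (\<Sum>i\<in>UNIV. x $ i * (y $ i - z $ i))"
    by (simp add: inner_vec_def sum_subtractf right_diff_distrib)
  also have "\<dots> \<le> (\<Sum>i\<in>(UNIV :: 'd set). 2)"
  proof (intro sum_mono)
    fix i
    have "\<bar>x $ i\<bar> \<le> 2" "\<bar>y $ i - z $ i\<bar> \<le> 1"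
      using assms by (auto simp: Omega_def Omega_tilde_def abs_le_iff) (smt (verit))+
    then have "\<bar>x $ i\<bar> * \<bar>y $ i - z $ i\<bar> \<le> 2 * 1"
      by (intro mult_mono) auto
    then show "x $ i * (y $ i - z $ i) \<le> 2"
      by (metis abs_le_D1 abs_mult mult_2 one_add_one)
  qed
  finally show ?thesis
    by simp
qed

text \<open>The affine functions under the supremum vary uniformly little between \<open>z\<close>
  and \<open>y\<close>. The bound \<open>b\<close> serves to make the supremum at \<open>z\<close>
  one of a bounded set, as a real \<open>SUP\<close> demands; its size does not affect the
  conclusion.\<close>

lemma conj_tilde_diff_le:
  fixes f :: "real ^ 'd \<Rightarrow> real"
  assumes bound: "\<And>x. x \<in> Omega_tilde \<Longrightarrow> \<bar>f x\<bar> \<le> b" and y: "y \<in> Omega" and z: "z \<in> Omega"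
  shows "conj_tilde f y \<le> conj_tilde f z + 2 * real CARD('d)"
  unfolding conj_tilde_def
proof (rule cSUP_least)
  show "(Omega_tilde :: (real ^ 'd) set) \<noteq> {}"
    using y Omega_subset_Omega_tilde by blast
  fix x :: "real ^ 'd" assume x: "x \<in> Omega_tilde"
  \<comment> \<open>Comparing \<open>z\<close> with the origin turns the difference estimate into a
    bound on \<open>x \<bullet> z\<close> itself.\<close>
  have zero: "(0 :: real ^ 'd) \<in> Omega"
    by (simp add: Omega_def)
  have "bdd_above ((\<lambda>x. x \<bullet> z - f x) ` Omega_tilde)"
  proof (rule bdd_aboveI2)
    fix x :: "real ^ 'd" assume "x \<in> Omega_tilde"
    then show "x \<bullet> z - f x \<le> 2 * real CARD('d) + b"
      using inner_Omega_tilde_diff_le[OF _ z zero, of x] bound[of x] by simp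
  qed
  then have "x \<bullet> z - f x \<le> (SUP x\<in>Omega_tilde. x \<bullet> z - f x)"
    using x by (intro cSUP_upper)
  then show "x \<bullet> y - f x \<le> (SUP x\<in>Omega_tilde. x \<bullet> z - f x) + 2 * real CARD('d)"
    using inner_Omega_tilde_diff_le[OF x y z] by linarith
qed

text \<open>Terms with \<open>u i = v i\<close> cancel. The remaining count is one of the two
  summands of \<open>hamming\<close>.\<close>

lemma sum_diff_le_card_neq:
  fixes g :: "'a \<Rightarrow> real"
  assumes "finite I" and "\<And>i. i \<in> I \<Longrightarrow> \<bar>g (u i) - g (v i)\<bar> \<le> b"
  shows "\<bar>(\<Sum>i\<in>I. g (u i)) - (\<Sum>i\<in>I. g (v i))\<bar> \<le> real (card {i \<in> I. u i \<noteq> v i}) * b"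
proof -
  have "\<bar>(\<Sum>i\<in>I. g (u i)) - (\<Sum>i\<in>I. g (v i))\<bar> \<le> (\<Sum>i\<in>I. \<bar>g (u i) - g (v i)\<bar>)"
    by (simp add: sum_subtractf[symmetric])
  also have "\<dots> = (\<Sum>i\<in>{i \<in> I. u i \<noteq> v i}. \<bar>g (u i) - g (v i)\<bar>)"
    using assms(1) by (intro sum.mono_neutral_right) auto
  also have "\<dots> \<le> real (card {i \<in> I. u i \<noteq> v i}) * b"
    using assms(2) by (intro sum_bounded_above) auto
  finally show ?thesis .
qed

text \<open>The maximum covers a changed entry of either kind: 16 M^2 is twice the bound on
  \<open>\<bar>f x\<bar>\<close>, and 2 d is the variation of the conjugate over the unit
  cube.\<close>

lemma S_hat_sensitivity:
  fixes f :: "real ^ 'd \<Rightarrow> real"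
  assumes "f \<in> calX_2 M" and D: "D \<in> datasets n" and D': "D' \<in> datasets n"
    and "neighboring n D D'"
  shows "\<bar>S_hat n f D - S_hat n f D'\<bar> \<le> max (16 * M\<^sup>2) (2 * real CARD('d)) / real n"
proof -
  define b where "b = max (16 * M\<^sup>2) (2 * real CARD('d))"
  define p where "p = card {i \<in> {1..n}. fst D i \<noteq> fst D' i}"
  define q where "q = card {i \<in> {1..n}. snd D i \<noteq> snd D' i}"
  have pq: "p + q \<le> 1"
    using assms(4) by (simp add: neighboring_def hamming_def p_def q_def)
  have "b \<ge> 0"
    by (simp add: b_def le_max_iff_disj)
  have mem: "fst D i \<in> Omega" "fst D' i \<in> Omega" "snd D i \<in> Omega" "snd D' i \<in> Omega"
    if "i \<in> {1..n}" for i
    using D D' that by (auto simp: datasets_def)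
  have bound: "\<bar>f x\<bar> \<le> 8 * M\<^sup>2" if "x \<in> Omega_tilde" for x
    using assms(1) that by (auto simp: calX_2_def)
  have X: "\<bar>(\<Sum>i=1..n. f (fst D i)) - (\<Sum>i=1..n. f (fst D' i))\<bar> \<le> real p * b"
    unfolding p_def
  proof (rule sum_diff_le_card_neq)
    fix i assume "i \<in> {1..n}"
    then have "\<bar>f (fst D i)\<bar> \<le> 8 * M\<^sup>2" "\<bar>f (fst D' i)\<bar> \<le> 8 * M\<^sup>2"
      using bound mem Omega_subset_Omega_tilde by blast+
    then show "\<bar>f (fst D i) - f (fst D' i)\<bar> \<le> b"
      unfolding b_def by linarith
  qed simp
  have Y: "\<bar>(\<Sum>i=1..n. conj_tilde f (snd D i)) - (\<Sum>i=1..n. conj_tilde f (snd D' i))\<bar> \<le> real q * b"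
    unfolding q_def
  proof (rule sum_diff_le_card_neq)
    fix i assume i: "i \<in> {1..n}"
    show "\<bar>conj_tilde f (snd D i) - conj_tilde f (snd D' i)\<bar> \<le> b"
      \<comment> \<open>The one-sided estimate is used in both directions to bound the absolute
        value.\<close>
      using conj_tilde_diff_le[where f = f, OF bound mem(3,4)[OF i]]
        conj_tilde_diff_le[where f = f, OF bound mem(4,3)[OF i]]
      unfolding b_def by linarith
  qed simp
  have "\<bar>S_hat n f D - S_hat n f D'\<bar> = \<bar>((\<Sum>i=1..n. f (fst D i)) - (\<Sum>i=1..n. f (fst D' i)))
      + ((\<Sum>i=1..n. conj_tilde f (snd D i)) - (\<Sum>i=1..n. conj_tilde f (snd D' i)))\<bar> / real n"
  proof -
    have "S_hat n f D - S_hat n f D' = (((\<Sum>i=1..n. f (fst D i)) - (\<Sum>i=1..n. f (fst D' i)))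
        + ((\<Sum>i=1..n. conj_tilde f (snd D i)) - (\<Sum>i=1..n. conj_tilde f (snd D' i)))) / real n"
      by (simp add: S_hat_def diff_divide_distrib add_divide_distrib)
    then show ?thesis
      by simp
  qed
  also have "\<dots> \<le> (real p * b + real q * b) / real n"
    using X Y by (intro divide_right_mono) linarith+
  also have "real p * b + real q * b = real (p + q) * b"
    by (simp add: distrib_right)
  \<comment> \<open>Since \<open>p + q \<le> 1\<close>, the bound \<open>b\<close> is paid at most
    once over both samples.\<close>
  also have "real (p + q) * b / real n \<le> b / real n"
    using pq \<open>b \<ge> 0\<close> by (intro divide_right_mono mult_left_le_one_le) auto
  finally show ?thesis
    by (simp add: b_def)
qed

section \<open>Privacy of the selected potential and its gradient\<close>

theorem theorem3p4:
  fixes \<epsilon> M :: real and n J N :: nat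
    and \<psi> :: "wavelet_kind \<Rightarrow> real \<Rightarrow> real"
    and C :: "(real ^ 'd \<Rightarrow> real) set" and f :: "nat \<Rightarrow> real ^ 'd \<Rightarrow> real"
    and P :: "'w measure" and L :: "nat \<Rightarrow> 'w \<Rightarrow> real"
    and T :: "'u measure" and U :: "'w \<Rightarrow> 'u"
    and i_priv :: "('d::finite) dataset \<Rightarrow> (nat \<Rightarrow> real) \<Rightarrow> 'u \<Rightarrow> nat"
  assumes "\<epsilon> > 0" and "n \<ge> 1" and "J \<ge> 1" and "M > 2"
    and "wavelet_system \<psi>"
    and "C = f ` {1..N}" and "C \<noteq> {}" and "C \<subseteq> Vspace \<psi> J \<inter> calX_2 M"
    and "prob_space P"
    and "\<And>i. i \<in> {1..N} \<Longrightarrow> distributed P lborel (L i) (\<lambda>t. ennreal (laplace_density t))"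
    and "prob_space.indep_vars P (\<lambda>_. borel) L {1..N}"
    \<comment> \<open>\<open>U\<close> is the remaining randomness, used to choose among several minimisers.\<close>
    and "indep_rv P (Pi\<^sub>M {1..N} (\<lambda>_. borel)) (\<lambda>\<omega>. \<lambda>i\<in>{1..N}. L i \<omega>) T U"
    and "\<And>D. D \<in> datasets n \<Longrightarrow>
      (\<lambda>(l, u). i_priv D l u) \<in> measurable (Pi\<^sub>M {1..N} (\<lambda>_. borel) \<Otimes>\<^sub>M T) (count_space UNIV)"
    and "\<And>D l u. D \<in> datasets n \<Longrightarrow> l \<in> space (Pi\<^sub>M {1..N} (\<lambda>_. borel)) \<Longrightarrow> u \<in> space T \<Longrightarrow>
      is_arg_min
        (\<lambda>i. S_hat n (f i) D + max (32 * M\<^sup>2) (36 * real CARD('d)) / (real n * \<epsilon>) * l i)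
        (\<lambda>i. i \<in> {1..N}) (i_priv D l u)"
  shows "differentially_private \<epsilon> (datasets n) (neighboring n)
      (count_space UNIV :: ((real ^ 'd \<Rightarrow> real) \<times> (real ^ 'd \<Rightarrow> real ^ 'd)) measure)
      (\<lambda>D. distr P (count_space UNIV)
        (\<lambda>\<omega>. let i = i_priv D (\<lambda>i\<in>{1..N}. L i \<omega>) (U \<omega>) in (f i, grad_on UNIV (f i))))"
proof -
  interpret P: prob_space P by fact
  let ?I = "{1..N}"
  define Z where "Z = (\<lambda>\<omega>. \<lambda>i\<in>?I. L i \<omega>)"
  define X where "X = (\<lambda>D \<omega>. i_priv D (Z \<omega>) (U \<omega>))"
  \<comment> \<open>Post-processing: the released pair is a fixed function of the index, so privacy
    is proved for the index and pulled back along \<open>out\<close>.\<close>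
  define out where "out = (\<lambda>i. (f i, grad_on UNIV (f i)))"
  define b where "b = max (16 * M\<^sup>2) (2 * real CARD('d)) / real n"
  define lam where "lam = max (32 * M\<^sup>2) (36 * real CARD('d)) / (real n * \<epsilon>)"
  have Z: "Z \<in> P \<rightarrow>\<^sub>M Pi\<^sub>M ?I (\<lambda>_. borel)" and U: "U \<in> P \<rightarrow>\<^sub>M T"
    using assms(12) by (auto simp: indep_rv_def Z_def)
  have X: "X D \<in> P \<rightarrow>\<^sub>M count_space UNIV" if "D \<in> datasets n" for D
    using measurable_compose[OF measurable_Pair[OF Z U] assms(13)[OF that]] by (simp add: X_def)
  \<comment> \<open>\<open>Z\<close> restricts the noise to \<open>?I\<close>; on the indices that
    compete in the minimum it agrees with \<open>L\<close>.\<close>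
  have amin: "is_arg_min (\<lambda>i. S_hat n (f i) D + lam * L i \<omega>) (\<lambda>i. i \<in> ?I) (X D \<omega>)"
    if "D \<in> datasets n" "\<omega> \<in> space P" for D \<omega>
    using assms(14)[OF that(1) measurable_space[OF Z that(2)] measurable_space[OF U that(2)]]
    by (auto simp: lam_def X_def Z_def is_arg_min_linorder)
  \<comment> \<open>The dimension term of the maximum is already positive.\<close>
  have "lam > 0"
    using assms(1,2) by (simp add: lam_def less_max_iff_disj)
  \<comment> \<open>After multiplying by \<open>n\<close>, this compares
    \<open>max (32 * M\<^sup>2) (4 * d)\<close> with \<open>max (32 * M\<^sup>2) (36 * d)\<close>,
    where \<open>d\<close> is the dimension.\<close>
  have lam_ge: "2 * b \<le> lam * \<epsilon>"
    using assms(1,2) by (auto simp: lam_def b_def field_simps max_def)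
  have dp: "measure P (X D -` V \<inter> space P) \<le> exp \<epsilon> * measure P (X D' -` V \<inter> space P)"
    if D: "D \<in> datasets n" "D' \<in> datasets n" "neighboring n D D'" for D D' V
  proof (rule report_noisy_min[OF assms(9) _ assms(10,11) \<open>lam > 0\<close> lam_ge])
    fix i assume "i \<in> ?I"
    then have "f i \<in> calX_2 M"
      using assms(6,8) by auto
    from S_hat_sensitivity[OF this D] show "\<bar>S_hat n (f i) D - S_hat n (f i) D'\<bar> \<le> b"
      by (simp add: b_def)
  qed (use assms(1) X amin D in auto)
  have mech: "(\<lambda>\<omega>. let i = i_priv D (\<lambda>i\<in>?I. L i \<omega>) (U \<omega>) in (f i, grad_on UNIV (f i)))
      = (\<lambda>\<omega>. out (X D \<omega>))" for D
    by (simp add: Let_def out_def X_def Z_def)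
  have out: "(\<lambda>\<omega>. out (X D \<omega>)) \<in> P \<rightarrow>\<^sub>M count_space UNIV" if "D \<in> datasets n" for D
    \<comment> \<open>Every map out of a discrete space is measurable, so nothing has to be known
      about \<open>out\<close>.\<close>
    using measurable_compose[OF X[OF that], of out "count_space UNIV"] by simp
  have law: "measure (distr P (count_space UNIV) (\<lambda>\<omega>. out (X D \<omega>))) S
      = measure P (X D -` (out -` S) \<inter> space P)" if "D \<in> datasets n" for D S
    using out[OF that] by (simp add: measure_distr vimage_def)
  show ?thesis
    unfolding differentially_private_def mech
  proof (intro conjI ballI impI)
    fix D :: "'d dataset" assume "D \<in> datasets n"
    then show "distr P (count_space UNIV) (\<lambda>\<omega>. out (X D \<omega>)) \<in> space (prob_algebra (count_space UNIV))"
      using P.prob_space_distr[OF out] by (simp add: space_prob_algebra)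
  qed (simp add: law dp)
qed

end
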